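(* For any $d\in\mathbb{N}$ and $\varepsilon>0$, there is a family of functions $f_1,\dots,f_n:2^{[m]}\to\mathbb{R}_{\ge0}$ with $\mathrm{SMW}(f_i)=d$ for all $i\in[n]$, such that any (possibly randomized) algorithm that produces a $(1/(d+1)+\varepsilon)$-approximation (with constant probability, if randomized) for the $n$-agent welfare maximization problem makes at least $\Omega\left((n/(2(d+1)))^{(m/n)^{0.99}}\right)$ value queries.
   Context: Set functions are normalized ($f(\emptyset)=0$) and monotone ($f(S)\le f(T)$ for $S\subseteq T$), accessed via value oracles. Write $f(v\mid T)=f(T\cup\{v\})-f(T)$. A set $T$ is supermodular w.r.t. $f$ if there exist $S\subseteq[m]$ and $v\in[m]\setminus T$ with $f(v\mid S\cup T)>\max_{T'\subsetneq T} f(v\mid S\cup T')$; $\mathrm{SMW}(f)$ is the maximum cardinality of a nonempty supermodular set (0 if none). The $n$-agent welfare maximization problem asks for pairwise disjoint $X_1,\dots,X_n\subseteq[m]$ maximizing $\sum_i f_i(X_i)$; an $\alpha$-approximation is an allocation with welfare at least $\alpha$ times the optimum. *)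

theory Defs
  imports "HOL-Probability.Probability"
begin

definition valuation :: "nat \<Rightarrow> (nat set \<Rightarrow> real) \<Rightarrow> bool" where
  "valuation m f \<longleftrightarrow>
     f {} = 0 \<and> mono_on (Pow {1..m}) f \<and> (\<forall>S\<subseteq>{1..m}. 0 \<le> f S)"

definition marginal :: "(nat set \<Rightarrow> real) \<Rightarrow> nat \<Rightarrow> nat set \<Rightarrow> real" where
  "marginal f v T = f (T \<union> {v}) - f T"

text \<open>Only meaningful for nonempty \<open>T\<close>: for \<open>T = {}\<close> the maximum ranges over the empty set.\<close>

definition supermodular_set :: "nat \<Rightarrow> (nat set \<Rightarrow> real) \<Rightarrow> nat set \<Rightarrow> bool" where
  "supermodular_set m f T \<longleftrightarrow>
     T \<subseteq> {1..m} \<and>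
     (\<exists>S\<subseteq>{1..m}. \<exists>v\<in>{1..m} - T.
        marginal f v (S \<union> T) > Max ((\<lambda>T'. marginal f v (S \<union> T')) ` {T'. T' \<subset> T}))"

definition SMW :: "nat \<Rightarrow> (nat set \<Rightarrow> real) \<Rightarrow> nat" where
  "SMW m f =
     (if \<exists>T. T \<noteq> {} \<and> supermodular_set m f T
      then Max (card ` {T. T \<noteq> {} \<and> supermodular_set m f T}) else 0)"

text \<open>
  An instance \<open>f\<close> with agents \<open>{1..n}\<close> and items \<open>{1..m}\<close> gives agent \<open>i\<close> the valuation \<open>f i\<close>;
  an allocation \<open>X\<close> gives agent \<open>i\<close> the bundle \<open>X i\<close>. Values at \<open>i \<notin> {1..n}\<close> are irrelevant.
\<close>

type_synonym welfare_inst = "nat \<Rightarrow> nat set \<Rightarrow> real"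
type_synonym alloc = "nat \<Rightarrow> nat set"

definition allocation :: "nat \<Rightarrow> nat \<Rightarrow> alloc \<Rightarrow> bool" where
  "allocation n m X \<longleftrightarrow> (\<forall>i\<in>{1..n}. X i \<subseteq> {1..m}) \<and> disjoint_family_on X {1..n}"

definition welfare :: "nat \<Rightarrow> welfare_inst \<Rightarrow> alloc \<Rightarrow> real" where
  "welfare n f X = (\<Sum>i\<in>{1..n}. f i (X i))"

definition opt_welfare :: "nat \<Rightarrow> nat \<Rightarrow> welfare_inst \<Rightarrow> real" where
  "opt_welfare n m f = Max (welfare n f ` {X. allocation n m X})"

definition approximates :: "nat \<Rightarrow> nat \<Rightarrow> real \<Rightarrow> welfare_inst \<Rightarrow> alloc \<Rightarrow> bool" where
  "approximates n m \<alpha> f X \<longleftrightarrow>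
     allocation n m X \<and> welfare n f X \<ge> \<alpha> * opt_welfare n m f"

text \<open>
  Deterministic adaptive algorithms in the value oracle model, as decision trees:
  \<open>Query i S k\<close> asks for the value of \<open>S\<close> to agent \<open>i\<close> and continues with \<open>k\<close> applied to the answer.
  Only queries are counted; computation is otherwise unrestricted.
\<close>

datatype vq_alg = Output alloc | Query nat "nat set" "real \<Rightarrow> vq_alg"

primrec legal :: "nat \<Rightarrow> nat \<Rightarrow> vq_alg \<Rightarrow> bool" where
  "legal n m (Output X) \<longleftrightarrow> True"
| "legal n m (Query i S k) \<longleftrightarrow> i \<in> {1..n} \<and> S \<subseteq> {1..m} \<and> (\<forall>x. legal n m (k x))"

primrec run :: "vq_alg \<Rightarrow> welfare_inst \<Rightarrow> alloc" where
  "run (Output X) f = X"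
| "run (Query i S k) f = run (k (f i S)) f"

primrec queries :: "vq_alg \<Rightarrow> welfare_inst \<Rightarrow> nat" where
  "queries (Output X) f = 0"
| "queries (Query i S k) f = Suc (queries (k (f i S)) f)"

text \<open>
  A randomized algorithm is a probability distribution over legal deterministic ones, on an
  arbitrary sigma-algebra. Since the measure of a non-measurable set is \<open>0\<close>, a positive lower bound
  on a success probability includes measurability of the success event.
\<close>

definition randomized_alg :: "nat \<Rightarrow> nat \<Rightarrow> vq_alg measure \<Rightarrow> bool" where
  "randomized_alg n m R \<longleftrightarrow> prob_space R \<and> space R \<subseteq> {A. legal n m A}"

definition success_prob ::
    "nat \<Rightarrow> nat \<Rightarrow> real \<Rightarrow> vq_alg measure \<Rightarrow> welfare_inst \<Rightarrow> real" where
  "success_prob n m \<alpha> R f =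
     measure R {A \<in> space R. approximates n m \<alpha> f (run A f)}"

definition query_bound :: "nat \<Rightarrow> nat \<Rightarrow> nat \<Rightarrow> real" where
  "query_bound d n m =
     (real n / (2 * (real d + 1))) powr ((real m / real n) powr (99 / 100))"

end

theory Submission
  imports Defs "HOL-Real_Asymp.Real_Asymp"
begin

text \<open>
  Let \<open>q = d + 1\<close>, \<open>k = m div n\<close> and \<open>s = \<lfloor>\<delta> k\<rfloor>\<close> for a small constant \<open>\<delta>\<close>. Agent \<open>i\<close> has a hidden set
  \<open>T i\<close> of \<open>k\<close> items, disjoint from those of the other agents. Every \<open>q\<close> items are worth \<open>1\<close>, except
  that each item of \<open>T i\<close> beyond the first \<open>s\<close> is worth \<open>1\<close> on its own; the total is capped at \<open>k\<close>.
  Since a unit jump occurs at least once among any \<open>q\<close> consecutive additions, the supermodular width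
  is \<open>q - 1 = d\<close>. Handing out the hidden sets yields welfare at least \<open>n (k - s)\<close>, whereas without
  hidden sets no allocation exceeds \<open>m / q\<close>.

  A query \<open>S\<close> to agent \<open>i\<close> reveals \<open>T i\<close> only if \<open>S\<close> has fewer than \<open>(q + 1) k\<close> items and meets
  \<open>T i\<close> in more than \<open>s\<close> of them, which for random hidden sets has probability at most
  \<open>2 ^ ((q + 1) k) / n ^ (s + 1)\<close>. So an algorithm with few queries behaves on most planted instances
  as on the instance without hidden sets. Randomized algorithms are handled by averaging over the
  hidden sets, and deterministic ones are point masses.
\<close>

section \<open>Hidden-set valuations and their supermodular width\<close>

definition level :: "nat \<Rightarrow> nat \<Rightarrow> nat set \<Rightarrow> nat set \<Rightarrow> nat" where
  "level q s T S = (min (card (S \<inter> T)) s + card (S - T)) div q + (card (S \<inter> T) - s)"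

text \<open>The cap \<open>c\<close> makes the hidden set invisible to large queries: once \<open>card S \<ge> (q + 1) * c\<close>, both
  the planted and the unplanted valuation equal \<open>c\<close>.\<close>

definition hidden_val :: "nat \<Rightarrow> nat \<Rightarrow> nat \<Rightarrow> nat set \<Rightarrow> nat set \<Rightarrow> real" where
  "hidden_val q s c T S = real (min c (level q s T S))"

lemma level_mono:
  assumes "S \<subseteq> S'" "finite S'"
  shows "level q s T S \<le> level q s T S'"
proof -
  have "card (S \<inter> T) \<le> card (S' \<inter> T)" "card (S - T) \<le> card (S' - T)"
    using assms by (auto intro!: card_mono)
  then show ?thesis
    unfolding level_def by (intro add_mono div_le_mono diff_le_mono) auto
qed

lemma level_insert:
  assumes "finite P" "v \<notin> P"
  shows "level q s T (insert v P) =
    (if v \<in> T then (min (Suc (card (P \<inter> T))) s + card (P - T)) div q + (Suc (card (P \<inter> T)) - s)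
     else Suc (min (card (P \<inter> T)) s + card (P - T)) div q + (card (P \<inter> T) - s))"
  using assms by (simp add: level_def Int_insert_left insert_Diff_if)

text \<open>Both differences depend only on the residue modulo \<open>q\<close>. This is used when a
  removal lowers the dividend in \<open>level\<close> by exactly \<open>q\<close>.\<close>

lemma div_Suc_add_self_diff:
  fixes a q :: nat
  assumes "0 < q" "q \<le> a"
  shows "Suc (a - q) div q - (a - q) div q = Suc a div q - a div q"
proof -
  obtain b where "a = b + q" using assms by (metis le_add_diff_inverse2)
  moreover have "Suc (b + q) = Suc b + q" by simp
  ultimately show ?thesis using assms by (simp only: div_add_self2) simp
qed

text \<open>Whenever the marginal of \<open>v\<close> is \<open>1\<close>, it is also \<open>1\<close> after a suitable removal: either the residue
  modulo \<open>q\<close> can be preserved, or the removal runs through all residues modulo \<open>q\<close>. This bounds the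
  supermodular width by \<open>q - 1\<close>.\<close>

lemma level_marginal_removal:
  assumes fin: "finite P" and v: "v \<notin> P" and R: "R \<subseteq> P" "card R = q" and q: "0 < q"
  obtains R' where "R' \<subseteq> R" "R' \<noteq> {}"
    "level q s T (insert v P) - level q s T P
      \<le> level q s T (insert v (P - R')) - level q s T (P - R')"
proof -
  define x y where "x = card (P \<inter> T)" and "y = card (P - T)"
  have finR: "finite R" using fin R finite_subset by blast
  have Rne: "R \<noteq> {}" using R q by auto
  have cards: "card ((P - R') \<inter> T) = x - card (R' \<inter> T)" "card (P - R' - T) = y - card (R' - T)"
     "card (R' \<inter> T) \<le> x" "card (R' - T) \<le> y" "card R' = card (R' \<inter> T) + card (R' - T)"
    if "R' \<subseteq> R" for R'
  proof -
    have f: "finite R'" "R' \<subseteq> P" using that R finR finite_subset by auto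
    have "(P - R') \<inter> T = (P \<inter> T) - (R' \<inter> T)" "P - R' - T = (P - T) - (R' - T)" by auto
    then show "card ((P - R') \<inter> T) = x - card (R' \<inter> T)" "card (P - R' - T) = y - card (R' - T)"
      using f by (auto simp: x_def y_def intro!: card_Diff_subset)
    show "card (R' \<inter> T) \<le> x" "card (R' - T) \<le> y"
      unfolding x_def y_def using f fin by (auto intro!: card_mono)
    show "card R' = card (R' \<inter> T) + card (R' - T)"
      using f card_Int_Diff by blast
  qed
  have P0: "level q s T P = (min x s + y) div q + (x - s)"
    by (simp add: level_def x_def y_def)
  have P1: "level q s T (insert v P) =
    (if v \<in> T then (min (Suc x) s + y) div q + (Suc x - s)
     else Suc (min x s + y) div q + (x - s))"
    using fin v by (simp add: level_insert x_def y_def)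
  have Q0: "level q s T (P - R') = (min (x - card (R' \<inter> T)) s + (y - card (R' - T))) div q
      + (x - card (R' \<inter> T) - s)" if "R' \<subseteq> R" for R'
    using cards[OF that] by (simp add: level_def)
  have Q1: "level q s T (insert v (P - R')) =
    (if v \<in> T then (min (Suc (x - card (R' \<inter> T))) s + (y - card (R' - T))) div q
          + (Suc (x - card (R' \<inter> T)) - s)
     else Suc (min (x - card (R' \<inter> T)) s + (y - card (R' - T))) div q
          + (x - card (R' \<inter> T) - s))" if "R' \<subseteq> R" for R'
    using cards[OF that] fin v by (simp add: level_insert)
  show thesis
  proof (cases "v \<in> T")
    case vT: True
    \<comment> \<open>If \<open>x < s\<close>, removing all of \<open>R\<close> lowers the dividend
      by \<open>q\<close>. If \<open>x\<close> is at least \<open>s\<close>, then \<open>v\<close>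
      earns its own unit, and still does after a one-element removal that leaves at least
      \<open>s\<close> hidden items. Only \<open>edge\<close> is left, where every removal makes
      \<open>v\<close> count towards the quotient.\<close>
    consider (below) "x < s" | (outside) u where "s \<le> x" "u \<in> R - T"
      | (above) "s < x" "R \<subseteq> T" | (edge) "s = x" "R \<subseteq> T"
      by force
    then show thesis
    proof cases
      case below
      have "Suc (x + y - q) div q - (x + y - q) div q = Suc (x + y) div q - (x + y) div q"
        using cards[of R] R q by (intro div_Suc_add_self_diff) auto
      moreover have "x - card (R \<inter> T) + (y - card (R - T)) = x + y - q"
        using cards[of R] R by auto
      ultimately show thesis
        using below vT Rne P0 P1 Q0[of R] Q1[of R] by (intro that[of R]) auto
    next
      case outside
      then have "{u} \<inter> T = {}" "{u} \<subseteq> R" by auto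
      then show thesis
        using outside vT P0 P1 Q0[of "{u}"] Q1[of "{u}"] by (intro that[of "{u}"]) auto
    next
      case above
      obtain u where "u \<in> R" using Rne by auto
      then have "{u} \<inter> T = {u}" "{u} - T = {}" "{u} \<subseteq> R" using above by auto
      then show thesis
        using above vT P0 P1 Q0[of "{u}"] Q1[of "{u}"] by (intro that[of "{u}"]) auto
    next
      case edge
      \<comment> \<open>After removing \<open>j\<close> items and adding \<open>v\<close>, the
        dividend is the largest multiple of \<open>q\<close> not exceeding \<open>s + y\<close>, so
        \<open>v\<close> completes a group. Since \<open>j\<close> is at most \<open>q\<close>, the
        set \<open>R\<close> has enough items.\<close>
      define j where "j = Suc ((s + y) mod q)"
      have "j \<le> card R" using q R by (simp add: j_def Suc_leI)
      then obtain R' where R': "R' \<subseteq> R" "card R' = j"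
        using obtain_subset_with_card_n by metis
      have sub: "R' \<inter> T = R'" "R' - T = {}" using R' edge by auto
      have subc: "card (R' \<inter> T) = j" "card (R' - T) = 0" using R'(2) by (simp_all only: sub card.empty)
      have "R' \<noteq> {}" using R' j_def by auto
      have "j \<le> s" using cards(3)[OF R'(1)] sub R' edge by simp
      have "Suc (s - j + y) = q * ((s + y) div q)"
        using \<open>j \<le> s\<close> by (simp add: j_def minus_mod_eq_mult_div[symmetric])
      then have "Suc (s - j + y) div q - (s - j + y) div q = 1"
        using q by (metis Suc_diff_le div_Suc dvd_triv_left dvd_imp_mod_0 Suc_eq_plus1 add_diff_cancel_left' le_refl)
      moreover have "Suc (s - j) \<le> s" using \<open>j \<le> s\<close> j_def by simp
      ultimately have "1 \<le> level q s T (insert v (P - R')) - level q s T (P - R')"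
        using vT R'(1) subc by (simp add: Q0 Q1 edge(1)[symmetric])
      moreover have "level q s T (insert v P) - level q s T P = 1"
        using vT by (simp add: P0 P1 edge(1)[symmetric])
      ultimately show thesis
        using R' \<open>R' \<noteq> {}\<close> by (intro that[of R']) auto
    qed
  next
    case vT: False
    \<comment> \<open>Here \<open>v\<close> always counts towards the quotient. Removing
      \<open>R\<close> lowers the dividend by \<open>q\<close> in the first two cases; in the last,
      dropping a surplus hidden item leaves it unchanged.\<close>
    consider (below) "x \<le> s" | (outside) "s < x" "R \<inter> T = {}"
      | (above) u where "s < x" "u \<in> R \<inter> T"
      by force
    then show thesis
    proof cases
      case below
      have "Suc (x + y - q) div q - (x + y - q) div q = Suc (x + y) div q - (x + y) div q"
        using cards[of R] R q by (intro div_Suc_add_self_diff) auto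
      moreover have "x - card (R \<inter> T) + (y - card (R - T)) = x + y - q"
        using cards[of R] R by auto
      ultimately show thesis
        using below vT Rne P0 P1 Q0[of R] Q1[of R] by (intro that[of R]) auto
    next
      case outside
      have "Suc (s + y - q) div q - (s + y - q) div q = Suc (s + y) div q - (s + y) div q"
        using cards[of R] R q outside by (intro div_Suc_add_self_diff) auto
      moreover have "s + (y - card (R - T)) = s + y - q"
        using cards[of R] R outside by auto
      ultimately show thesis
        using outside vT Rne P0 P1 Q0[of R] Q1[of R] by (intro that[of R]) auto
    next
      case above
      then have "{u} \<inter> T = {u}" "{u} - T = {}" "{u} \<subseteq> R" by auto
      then show thesis
        using above vT P0 P1 Q0[of "{u}"] Q1[of "{u}"] by (intro that[of "{u}"]) auto
    qed
  qed
qed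

lemma valuation_hidden_val: "valuation m (hidden_val q s c T)"
proof -
  have "hidden_val q s c T S \<le> hidden_val q s c T S'" if "S \<subseteq> S'" "S' \<subseteq> {1..m}" for S S'
    using level_mono[OF that(1), of q s T] that finite_subset[OF that(2)]
    by (auto simp: hidden_val_def)
  then show ?thesis
    by (auto simp: valuation_def mono_on_def hidden_val_def level_def)
qed

text \<open>Inside a larger \<open>Q\<close>, some nonempty removal \<open>R'\<close> does not
  decrease the marginal of \<open>level\<close>, so the proper subset \<open>Q - R'\<close> violates
  strictness.\<close>

lemma supermodular_set_hidden_val_card_less:
  assumes q: "0 < q" and sup: "supermodular_set m (hidden_val q s c T) Q"
  shows "card Q < q"
proof (rule ccontr)
  assume "\<not> card Q < q"
  let ?f = "hidden_val q s c T"
  from sup obtain S v where S: "S \<subseteq> {1..m}" and v: "v \<in> {1..m} - Q" and Qm: "Q \<subseteq> {1..m}"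
    and gt: "marginal ?f v (S \<union> Q) > Max ((\<lambda>T'. marginal ?f v (S \<union> T')) ` {T'. T' \<subset> Q})"
    unfolding supermodular_set_def by blast
  have finQ: "finite Q" and finP: "finite (S \<union> Q)"
    using S Qm finite_subset by (blast intro: finite_subset[OF _ finite_atLeastAtMost])+
  have less: "marginal ?f v (S \<union> T') < marginal ?f v (S \<union> Q)" if "T' \<subset> Q" for T'
  proof -
    have "finite {T'. T' \<subset> Q}"
      using finQ by (rule_tac finite_subset[of _ "Pow Q"]) auto
    then have "marginal ?f v (S \<union> T') \<le> Max ((\<lambda>T'. marginal ?f v (S \<union> T')) ` {T'. T' \<subset> Q})"
      using that by (intro Max_ge) auto
    then show ?thesis using gt by simp
  qed
  \<comment> \<open>Otherwise \<open>Q - S\<close> is a proper subset of \<open>Q\<close> with the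
    same union with \<open>S\<close>, hence the same marginal.\<close>
  have disj: "S \<inter> Q = {}"
  proof (rule ccontr)
    assume "S \<inter> Q \<noteq> {}"
    then have "Q - S \<subset> Q" by auto
    from less[OF this] show False by simp
  qed
  obtain R where R: "R \<subseteq> Q" "card R = q"
    using \<open>\<not> card Q < q\<close> obtain_subset_with_card_n by (metis not_less)
  have "v \<notin> S"
  proof
    assume "v \<in> S"
    moreover have "{} \<subset> Q" using R q by auto
    ultimately show False using less[of "{}"] by (simp add: marginal_def insert_absorb)
  qed
  then have "v \<notin> S \<union> Q" using v by auto
  then obtain R' where R': "R' \<subseteq> R" "R' \<noteq> {}"
    and le: "level q s T (insert v (S \<union> Q)) - level q s T (S \<union> Q)
      \<le> level q s T (insert v (S \<union> Q - R')) - level q s T (S \<union> Q - R')"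
    using level_marginal_removal[OF finP, of v R q s T] R q by blast
  have "Q - R' \<subset> Q" using R R' by auto
  moreover have "S \<union> (Q - R') = S \<union> Q - R'" using R R' disj by auto
  ultimately have "marginal ?f v (S \<union> Q - R') < marginal ?f v (S \<union> Q)"
    using less[of "Q - R'"] by simp
  \<comment> \<open>The cap respects the comparison: the levels after the removal are lower, so it
    cuts off no more of the gain there.\<close>
  moreover have "level q s T (S \<union> Q - R') \<le> level q s T (S \<union> Q)"
    "level q s T (S \<union> Q) \<le> level q s T (insert v (S \<union> Q))"
    "level q s T (S \<union> Q - R') \<le> level q s T (insert v (S \<union> Q - R'))"
    using finP by (auto intro!: level_mono)
  ultimately show False
    using le by (simp add: marginal_def hidden_val_def min_def split: if_splits)
qed

text \<open>The lower bound is witnessed by \<open>d\<close> items outside \<open>T\<close>: one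
  more item completes the first group of \<open>d + 1\<close>, and no proper subset gets that
  far.\<close>

lemma SMW_hidden_val:
  assumes "1 \<le> c" and "d < card ({1..m} - T)"
  shows "SMW m (hidden_val (Suc d) s c T) = d"
proof -
  let ?f = "hidden_val (Suc d) s c T"
  let ?A = "{Q. Q \<noteq> {} \<and> supermodular_set m ?f Q}"
  have le: "card Q \<le> d" if "Q \<in> ?A" for Q
    using supermodular_set_hidden_val_card_less[of "Suc d" m s c T Q] that by auto
  have fin: "finite ?A"
    by (rule finite_subset[of _ "Pow {1..m}"]) (auto simp: supermodular_set_def)
  show ?thesis
  \<comment> \<open>For \<open>d = 0\<close> no nonempty set qualifies, and the default value in
    \<open>SMW\<close> applies.\<close>
  proof (cases "d = 0")
    case True
    have "?A = {}"
    proof (rule ccontr)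
      assume "?A \<noteq> {}"
      then obtain Q where Q: "Q \<in> ?A" by auto
      then have "finite Q" by (auto simp: supermodular_set_def intro: finite_subset)
      then show False using le[OF Q] Q True by auto
    qed
    then show ?thesis using True by (auto simp: SMW_def)
  next
    case False
    obtain U where U: "U \<subseteq> {1..m} - T" "card U = Suc d"
      using assms(2) obtain_subset_with_card_n by (metis Suc_leI)
    then obtain v Q where vQ: "U = insert v Q" "v \<notin> Q" "card Q = d"
      by (auto simp: card_Suc_eq)
    have finQ: "finite Q" using vQ False card_ge_0_finite by auto
    have val: "?f P = real (min c (card P div Suc d))" if "P \<subseteq> U" for P
    proof -
      have "P \<inter> T = {}" "P - T = P" using that U by auto
      then show ?thesis by (simp add: hidden_val_def level_def)
    qed
    have top: "marginal ?f v Q = 1"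
      using vQ finQ assms(1) val[of Q] val[of "insert v Q"] by (auto simp: marginal_def)
    have low: "marginal ?f v Q' = 0" if "Q' \<subset> Q" for Q'
    proof -
      have "card Q' < d" "finite Q'" "v \<notin> Q'" "Q' \<subseteq> U" "insert v Q' \<subseteq> U"
        using psubset_card_mono[OF finQ that] that vQ finQ finite_subset by auto
      then show ?thesis by (simp add: marginal_def val)
    qed
    have "Q \<noteq> {}" using vQ False by auto
    have fin': "finite {Q'. Q' \<subset> Q}"
      using finQ by (rule_tac finite_subset[of _ "Pow Q"]) auto
    have "Max ((\<lambda>T'. marginal ?f v T') ` {T'. T' \<subset> Q}) < 1"
      using \<open>Q \<noteq> {}\<close> fin' by (subst Max_less_iff) (auto simp: low)
    then have "supermodular_set m ?f Q"
      unfolding supermodular_set_def using U vQ top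
      by (intro conjI exI[of _ "{}"] bexI[of _ v]) auto
    then have "Q \<in> ?A" using \<open>Q \<noteq> {}\<close> by simp
    then have "Max (card ` ?A) = d"
      using fin le vQ by (intro Max_eqI) auto
    then show ?thesis using \<open>Q \<in> ?A\<close> by (auto simp: SMW_def)
  qed
qed

section \<open>Planting disjoint hidden sets by cyclic shifts\<close>

text \<open>The first \<open>n * k\<close> items form \<open>k\<close> blocks of \<open>n\<close> items, and agent \<open>i\<close> is planted one item of each
  block, at a position given by a cyclic shift \<open>r j\<close> of block \<open>j\<close>. Independent uniform shifts replace a
  uniformly random equipartition, so all counting factorizes over the blocks.\<close>

definition item :: "nat \<Rightarrow> nat \<Rightarrow> nat \<Rightarrow> nat" where
  "item n j a = j * n + a mod n + 1"

definition planted :: "nat \<Rightarrow> nat \<Rightarrow> (nat \<Rightarrow> nat) \<Rightarrow> alloc" where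
  "planted n k r i = (\<lambda>j. item n j (i + r j)) ` {..<k}"

lemma item_eq_iff:
  assumes "0 < n"
  shows "item n j a = item n j' a' \<longleftrightarrow> j = j' \<and> a mod n = a' mod n"
proof
  assume "item n j a = item n j' a'"
  then have eq: "j * n + a mod n = j' * n + a' mod n" by (simp add: item_def)
  then have "(j * n + a mod n) div n = (j' * n + a' mod n) div n"
    "(j * n + a mod n) mod n = (j' * n + a' mod n) mod n" by simp_all
  then show "j = j' \<and> a mod n = a' mod n" using assms by simp
qed (simp add: item_def)

lemma mod_add_left_cancel_less:
  fixes i a b n :: nat
  assumes "(i + a) mod n = (i + b) mod n" "a < n" "b < n"
  shows "a = b"
proof -
  have "u \<le> v" if "(i + u) mod n = (i + v) mod n" "u < n" for u v
  proof (rule ccontr)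
    assume "\<not> u \<le> v"
    then have "n dvd (i + u) - (i + v)" using that by (subst mod_eq_dvd_iff_nat[symmetric]) auto
    then show False using that \<open>\<not> u \<le> v\<close> by (auto dest: dvd_imp_le)
  qed
  from this[of a b] this[of b a] show ?thesis using assms by simp
qed

lemma planted_subset:
  assumes "0 < n" "n * k \<le> m"
  shows "planted n k r i \<subseteq> {1..m}"
proof -
  have "item n j a \<in> {1..m}" if "j < k" for j a
  proof -
    have "j * n + a mod n < Suc j * n" using assms by simp
    also have "\<dots> \<le> k * n" using that by (intro mult_le_mono1) simp
    finally show ?thesis using assms by (simp add: item_def mult.commute)
  qed
  then show ?thesis by (auto simp: planted_def)
qed

lemma card_planted_Int:
  assumes "0 < n"
  shows "card (S \<inter> planted n k r i) = card {j \<in> {..<k}. item n j (i + r j) \<in> S}"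
proof -
  have "S \<inter> planted n k r i = (\<lambda>j. item n j (i + r j)) ` {j \<in> {..<k}. item n j (i + r j) \<in> S}"
    by (auto simp: planted_def)
  moreover have "inj_on (\<lambda>j. item n j (i + r j)) {j \<in> {..<k}. item n j (i + r j) \<in> S}"
    using assms by (auto simp: inj_on_def item_eq_iff)
  ultimately show ?thesis by (simp add: card_image)
qed

lemma card_planted:
  assumes "0 < n"
  shows "card (planted n k r i) = k"
  using card_planted_Int[OF assms, of UNIV] by simp

text \<open>All agents share the shift of a block, so distinct agents occupy distinct positions
  modulo \<open>n\<close>.\<close>

lemma allocation_planted:
  assumes "0 < n" "n * k \<le> m"
  shows "allocation n m (planted n k r)"
proof -
  have "planted n k r i \<inter> planted n k r i' = {}" if "i \<in> {1..n}" "i' \<in> {1..n}" "i \<noteq> i'" for i i'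
  proof (rule ccontr)
    assume "planted n k r i \<inter> planted n k r i' \<noteq> {}"
    then obtain j j' where "item n j (i + r j) = item n j' (i' + r j')"
      unfolding planted_def by auto
    then have "(i + r j) mod n = (i' + r j) mod n" using assms(1) by (auto simp: item_eq_iff)
    \<comment> \<open>Agents are numbered from \<open>1\<close>; subtracting \<open>1\<close> brings
      them below \<open>n\<close>, as the cancellation lemma requires.\<close>
    then have "(r j + 1 + (i - 1)) mod n = (r j + 1 + (i' - 1)) mod n"
      using that by (simp add: add.commute)
    then have "i - 1 = i' - 1"
      by (rule mod_add_left_cancel_less) (use that in auto)
    then show False using that by auto
  qed
  then show ?thesis
    using planted_subset[OF assms] unfolding allocation_def disjoint_family_on_def by blast
qed

section \<open>Counting the shifts that a query can detect\<close>

abbreviation shifts :: "nat \<Rightarrow> nat \<Rightarrow> (nat \<Rightarrow> nat) set" where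
  "shifts n k \<equiv> PiE {..<k} (\<lambda>_. {..<n})"

text \<open>A moment generating function bound, with weight \<open>n\<close> per planted item that is hit.\<close>

lemma sum_power_card_planted_Int_le:
  assumes n: "0 < n" and S: "finite S"
  shows "(\<Sum>r\<in>shifts n k. n ^ card (S \<inter> planted n k r i)) \<le> n ^ k * 2 ^ card S"
proof -
  \<comment> \<open>The number of positions in block \<open>j\<close> that lie in \<open>S\<close>.
    Blocks are disjoint, so these numbers add up to at most \<open>card S\<close>.\<close>
  define c where "c j = card {a \<in> {..<n}. item n j (i + a) \<in> S}" for j
  have csum: "(\<Sum>j<k. c j) \<le> card S"
  proof -
    let ?D = "SIGMA j:{..<k}. {a \<in> {..<n}. item n j (i + a) \<in> S}"
    have "(\<Sum>j<k. c j) = card ?D" by (simp add: c_def)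
    also have "\<dots> \<le> card S"
    proof (rule card_inj_on_le[where f = "\<lambda>(j, a). item n j (i + a)"])
      show "inj_on (\<lambda>(j, a). item n j (i + a)) ?D"
        using n by (auto simp: inj_on_def item_eq_iff intro: mod_add_left_cancel_less[of i _ n])
    qed (use S in auto)
    finally show ?thesis .
  qed
  have "n ^ card (S \<inter> planted n k r i)
      = (\<Prod>j<k. if item n j (i + r j) \<in> S then n else 1)" for r
    unfolding card_planted_Int[OF n] by (simp add: prod.If_cases Int_def)
  then have "(\<Sum>r\<in>shifts n k. n ^ card (S \<inter> planted n k r i))
      = (\<Prod>j<k. \<Sum>a<n. if item n j (i + a) \<in> S then n else 1)"
    by (simp add: prod_sum_PiE[where f = "\<lambda>j a. if item n j (i + a) \<in> S then n else 1"])
  \<comment> \<open>Each block sum has \<open>c j\<close> terms equal to \<open>n\<close> and the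
    others equal to \<open>1\<close>, so it is at most \<open>n * (c j + 1)\<close>.\<close>
  also have "\<dots> \<le> (\<Prod>j<k. n * 2 ^ c j)"
  proof (rule prod_mono, intro conjI)
    fix j
    have "(\<Sum>a<n. if item n j (i + a) \<in> S then n else 1)
        \<le> (\<Sum>a<n. (if item n j (i + a) \<in> S then n else 0) + 1)"
      by (intro sum_mono) auto
    also have "\<dots> = n * (c j + 1)"
      unfolding sum.distrib by (simp add: c_def sum.If_cases Int_def)
    also have "\<dots> \<le> n * 2 ^ c j"
      by (intro mult_le_mono2) (simp add: Suc_leI)
    finally show "(\<Sum>a<n. if item n j (i + a) \<in> S then n else 1) \<le> n * 2 ^ c j" .
  qed auto
  also have "\<dots> = n ^ k * 2 ^ (\<Sum>j<k. c j)"
    by (simp add: prod.distrib power_sum)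
  also have "\<dots> \<le> n ^ k * 2 ^ card S"
    using csum by (intro mult_le_mono2 power_increasing) auto
  finally show ?thesis .
qed

text \<open>Markov's inequality: each heavy shift contributes at least \<open>n ^ Suc s\<close> to
  the weighted sum.\<close>

lemma card_shifts_heavy_le:
  assumes n: "0 < n" and S: "finite S"
  shows "card {r \<in> shifts n k. s < card (S \<inter> planted n k r i)} * n ^ Suc s \<le> n ^ k * 2 ^ card S"
proof -
  let ?B = "{r \<in> shifts n k. s < card (S \<inter> planted n k r i)}"
  have fin: "finite (shifts n k)" by (intro finite_PiE) auto
  have "card ?B * n ^ Suc s = (\<Sum>r\<in>?B. n ^ Suc s)" by simp
  also have "\<dots> \<le> (\<Sum>r\<in>?B. n ^ card (S \<inter> planted n k r i))"
    using n by (intro sum_mono power_increasing) auto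
  also have "\<dots> \<le> (\<Sum>r\<in>shifts n k. n ^ card (S \<inter> planted n k r i))"
    using fin by (intro sum_mono2) auto
  also note sum_power_card_planted_Int_le[OF n S]
  finally show ?thesis .
qed

text \<open>A small intersection has no surplus items. A large \<open>S\<close> has at least
  \<open>q * c\<close> items outside \<open>T\<close>, so both values reach the cap.\<close>

lemma hidden_val_eq_hidden_val_empty:
  assumes S: "finite S" and T: "finite T" "card T \<le> c" and q: "0 < q"
    and "card (S \<inter> T) \<le> s \<or> (q + 1) * c \<le> card S"
  shows "hidden_val q s c T S = hidden_val q s c {} S"
proof -
  have cS: "card S = card (S \<inter> T) + card (S - T)" using S card_Int_Diff by blast
  show ?thesis
  proof (cases "card (S \<inter> T) \<le> s")
    case True
    then show ?thesis using cS by (simp add: hidden_val_def level_def)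
  next
    case False
    have "card (S \<inter> T) \<le> c" using T card_mono[of T "S \<inter> T"] by auto
    then have "c * q \<le> min (card (S \<inter> T)) s + card (S - T)" "c * q \<le> card S"
      using assms(5) False cS by (auto simp: algebra_simps)
    then have "c \<le> (min (card (S \<inter> T)) s + card (S - T)) div q" "c \<le> card S div q"
      using q by (simp_all add: less_eq_div_iff_mult_less_eq)
    then show ?thesis by (simp add: hidden_val_def level_def)
  qed
qed

text \<open>Large sets detect nothing, and for the others \<open>card S\<close> is below
  \<open>(q + 1) * k\<close>; hence a bound uniform in \<open>S\<close>. Dividing by
  \<open>n ^ k\<close>, the number of shifts, turns it into a probability.\<close>

lemma card_distinguishing_shifts_le:
  assumes n: "0 < n" and S: "finite S" and q: "0 < q"
  shows "card {r \<in> shifts n k. hidden_val q s k (planted n k r i) S \<noteq> hidden_val q s k {} S}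
     * n ^ Suc s \<le> n ^ k * 2 ^ ((q + 1) * k)"
proof -
  have eq: "hidden_val q s k (planted n k r i) S = hidden_val q s k {} S"
    if "card (S \<inter> planted n k r i) \<le> s \<or> (q + 1) * k \<le> card S" for r
  proof (rule hidden_val_eq_hidden_val_empty[OF S _ _ q that])
    show "finite (planted n k r i)" by (simp add: planted_def)
  qed (simp add: card_planted n)
  show ?thesis
  proof (cases "(q + 1) * k \<le> card S")
    case True
    then have "{r \<in> shifts n k. hidden_val q s k (planted n k r i) S \<noteq> hidden_val q s k {} S} = {}"
      using eq by blast
    then show ?thesis by (simp only: card.empty mult_0 zero_le)
  next
    case False
    have fin: "finite (shifts n k)" by (intro finite_PiE) auto
    have "{r \<in> shifts n k. hidden_val q s k (planted n k r i) S \<noteq> hidden_val q s k {} S}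
        \<subseteq> {r \<in> shifts n k. s < card (S \<inter> planted n k r i)}"
      using eq not_le_imp_less by blast
    then have "card {r \<in> shifts n k. hidden_val q s k (planted n k r i) S \<noteq> hidden_val q s k {} S}
        \<le> card {r \<in> shifts n k. s < card (S \<inter> planted n k r i)}"
      using fin by (intro card_mono) auto
    then have "card {r \<in> shifts n k. hidden_val q s k (planted n k r i) S \<noteq> hidden_val q s k {} S}
        * n ^ Suc s \<le> n ^ k * 2 ^ card S"
      using card_shifts_heavy_le[OF n S, of k s i] by (meson le_trans mult_le_mono1)
    also have "\<dots> \<le> n ^ k * 2 ^ ((q + 1) * k)"
      using False by (intro mult_le_mono2 power_increasing) auto
    finally show ?thesis .
  qed
qed

section \<open>Asymptotics of the query bound\<close>

text \<open>With \<open>k = m div n\<close>, the exponent \<open>\<delta> * k\<close> is split: a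
  quarter pays for the queries (large \<open>k\<close>), a quarter for the power of \<open>2\<close>
  (large \<open>n\<close>), and the remaining half for the factor \<open>2 / p\<close>. The summand
  \<open>real n\<close> accounts for the output bundles.\<close>

lemma query_bound_dominated:
  fixes \<delta> p :: real and d :: nat
  assumes \<delta>: "\<delta> > 0" and p: "p > 0"
  shows "\<exists>N. \<forall>n\<ge>N. \<forall>m\<ge>N * n.
    (query_bound d n m + real n) * 2 ^ ((d + 2) * (m div n))
      < p * real n ^ Suc (nat \<lfloor>\<delta> * real (m div n)\<rfloor>)"
proof -
  have "eventually (\<lambda>x::real. (x + 1) powr (99/100) \<le> \<delta> / 4 * x \<and> 1 \<le> x) at_top"
    using \<delta> by (intro eventually_conj; real_asymp)
  then obtain K where K: "\<And>x. x \<ge> K \<Longrightarrow> (x + 1) powr (99/100) \<le> \<delta> / 4 * x \<and> 1 \<le> x"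
    unfolding eventually_at_top_linorder by blast
  have "eventually (\<lambda>x::real. 2 ^ (d + 2) < x powr (\<delta> / 4) \<and> 2 / p < x powr (\<delta> / 2)
      \<and> 2 * (real d + 1) < x) at_top"
    using \<delta> p by (intro eventually_conj; real_asymp)
  then obtain L where L: "\<And>x. x \<ge> L \<Longrightarrow> 2 ^ (d + 2) < x powr (\<delta> / 4)
      \<and> 2 / p < x powr (\<delta> / 2) \<and> 2 * (real d + 1) < x"
    unfolding eventually_at_top_linorder by blast
  define N where "N = nat \<lceil>max K L\<rceil>"
  have "(query_bound d n m + real n) * 2 ^ ((d + 2) * (m div n))
      < p * real n ^ Suc (nat \<lfloor>\<delta> * real (m div n)\<rfloor>)" if n: "n \<ge> N" and m: "m \<ge> N * n" for n m
  proof -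
    define k where "k = m div n"
    define e where "e = (real k + 1) powr (99/100)"
    have "real n \<ge> L" using n unfolding N_def by linarith
    note Ln = L[OF this]
    then have n2: "real n > 2 * (real d + 1)" by blast
    then have n1: "real n \<ge> 1" by (cases n) auto
    have "k \<ge> N" unfolding k_def using m n1 by (simp add: less_eq_div_iff_mult_less_eq)
    then have "real k \<ge> K" unfolding N_def by linarith
    note Kk = K[OF this]
    have e1: "1 \<le> e" unfolding e_def by (rule ge_one_powr_ge_zero) auto
    have mn: "real m / real n \<le> real k + 1"
    proof -
      have "m < n * Suc k" unfolding k_def
        using n1 dividend_less_times_div[of n m] by (simp add: algebra_simps)
      then have "real m \<le> real n * (real k + 1)"
        by (metis of_nat_mono of_nat_mult of_nat_Suc less_imp_le add.commute)
      then show ?thesis using n1 by (simp add: field_simps)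
    qed
    have "query_bound d n m \<le> (real n / (2 * (real d + 1))) powr e"
      unfolding query_bound_def e_def using n2 mn
      by (intro powr_mono powr_mono2) (auto simp: field_simps)
    also have "\<dots> \<le> real n powr e"
      using e1 n1 by (intro powr_mono2) (auto simp: field_simps)
    finally have "query_bound d n m + real n \<le> 2 * real n powr e"
      using powr_mono[of 1 e "real n"] e1 n1 by simp
    also have "\<dots> \<le> 2 * real n powr (\<delta> / 4 * real k)"
      using Kk n1 by (intro mult_left_mono powr_mono) (auto simp: e_def)
    finally have 1: "query_bound d n m + real n \<le> 2 * real n powr (\<delta> / 4 * real k)" .
    have "(2::real) ^ ((d + 2) * k) = (2 ^ (d + 2)) ^ k" by (rule power_mult)
    also have "\<dots> \<le> (real n powr (\<delta> / 4)) ^ k"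
      using Ln by (intro power_mono) auto
    also have "\<dots> = real n powr (\<delta> / 4 * real k)"
      using n1 by (simp add: powr_powr flip: powr_realpow)
    finally have 2: "(2::real) ^ ((d + 2) * k) \<le> real n powr (\<delta> / 4 * real k)" .
    have "2 < p * real n powr (\<delta> / 2)" using Ln p by (simp add: field_simps)
    also have "\<dots> \<le> p * real n powr (\<delta> / 2 * real k)"
      using Kk n1 p \<delta> by (intro mult_left_mono powr_mono) auto
    finally have 3: "2 < p * real n powr (\<delta> / 2 * real k)" .
    have "(query_bound d n m + real n) * 2 ^ ((d + 2) * k)
        \<le> (2 * real n powr (\<delta> / 4 * real k)) * real n powr (\<delta> / 4 * real k)"
      using 1 2 by (intro mult_mono) auto
    also have "\<dots> = 2 * real n powr (\<delta> / 2 * real k)"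
      by (simp flip: powr_add add: algebra_simps)
    also have "\<dots> < p * real n powr (\<delta> / 2 * real k) * real n powr (\<delta> / 2 * real k)"
      using 3 n1 by (intro mult_strict_right_mono) auto
    also have "\<dots> = p * real n powr (\<delta> * real k)"
      by (simp flip: powr_add add: algebra_simps)
    \<comment> \<open>The successor makes up for rounding \<open>\<delta> * k\<close> down.\<close>
    also have "\<dots> \<le> p * real n powr real (Suc (nat \<lfloor>\<delta> * real k\<rfloor>))"
      using n1 p by (intro mult_left_mono powr_mono) (auto, linarith)
    also have "\<dots> = p * real n ^ Suc (nat \<lfloor>\<delta> * real k\<rfloor>)"
      using n1 by (subst powr_realpow) auto
    finally show ?thesis by (simp add: k_def)
  qed
  then show ?thesis by blast
qed

section \<open>Query traces and welfare estimates\<close>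

primrec trace :: "vq_alg \<Rightarrow> welfare_inst \<Rightarrow> (nat \<times> nat set) list" where
  "trace (Output X) f = []"
| "trace (Query i S k) f = (i, S) # trace (k (f i S)) f"

lemma length_trace: "length (trace A f) = queries A f"
  by (induction A) auto

lemma legal_trace: "legal n m A \<Longrightarrow> (i, S) \<in> set (trace A f) \<Longrightarrow> S \<subseteq> {1..m}"
  by (induction A) auto

text \<open>Each query depends only on earlier answers, so agreement along the trace for
  \<open>f\<close> alone forces the same path. This handles adaptivity.\<close>

lemma run_cong: "(\<And>i S. (i, S) \<in> set (trace A f) \<Longrightarrow> g i S = f i S) \<Longrightarrow> run A g = run A f"
  by (induction A) auto

lemma welfare_le_opt_welfare:
  assumes "allocation n m X"
  shows "welfare n f X \<le> opt_welfare n m f"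
proof -
  \<comment> \<open>Allocations are arbitrary outside \<open>{1..n}\<close>, so there may be
    infinitely many; restricting them shows that the set under \<open>Max\<close> is finite.\<close>
  have "welfare n f ` {X. allocation n m X} \<subseteq> welfare n f ` (PiE {1..n} (\<lambda>_. Pow {1..m}))"
  proof
    fix w assume "w \<in> welfare n f ` {X. allocation n m X}"
    then obtain Y where Y: "allocation n m Y" "w = welfare n f Y" by auto
    then have "w = welfare n f (restrict Y {1..n})" by (simp add: welfare_def)
    moreover have "restrict Y {1..n} \<in> PiE {1..n} (\<lambda>_. Pow {1..m})"
      using Y by (auto simp: allocation_def)
    ultimately show "w \<in> welfare n f ` (PiE {1..n} (\<lambda>_. Pow {1..m}))" by blast
  qed
  then have "finite (welfare n f ` {X. allocation n m X})"
    by (rule finite_subset) (intro finite_imageI finite_PiE, auto)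
  then show ?thesis unfolding opt_welfare_def using assms by (intro Max_ge) auto
qed

text \<open>Without a hidden set a bundle is worth at most its size divided by \<open>q\<close>, and
  disjoint bundles contain at most \<open>m\<close> items altogether.\<close>

lemma welfare_hidden_val_empty_le:
  assumes "allocation n m X"
  shows "welfare n (\<lambda>_. hidden_val q s c {}) X \<le> real m / real q"
proof -
  have sub: "(\<Union>i\<in>{1..n}. X i) \<subseteq> {1..m}" and disj: "disjoint_family_on X {1..n}"
    using assms by (auto simp: allocation_def)
  then have fin: "finite (X i)" if "i \<in> {1..n}" for i
    using that by (blast intro: finite_subset[OF _ finite_atLeastAtMost])
  have "welfare n (\<lambda>_. hidden_val q s c {}) X \<le> (\<Sum>i\<in>{1..n}. real (card (X i)) / real q)"
    unfolding welfare_def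
  proof (rule sum_mono)
    fix i
    have "hidden_val q s c {} (X i) \<le> real (card (X i) div q)"
      by (simp add: hidden_val_def level_def)
    also have "\<dots> \<le> real (card (X i)) / real q" by (rule of_nat_div_le_of_nat)
    finally show "hidden_val q s c {} (X i) \<le> real (card (X i)) / real q" .
  qed
  also have "\<dots> = real (\<Sum>i\<in>{1..n}. card (X i)) / real q"
    by (simp add: sum_divide_distrib)
  also have "(\<Sum>i\<in>{1..n}. card (X i)) = card (\<Union>i\<in>{1..n}. X i)"
    using fin disj by (subst card_UN_disjoint) (auto simp: disjoint_family_on_def)
  also have "real \<dots> / real q \<le> real m / real q"
    using card_mono[OF _ sub] by (intro divide_right_mono) auto
  finally show ?thesis .
qed

lemma opt_welfare_planted_ge:
  assumes "0 < n" "n * k \<le> m" "s \<le> k"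
  shows "real n * (real k - real s) \<le> opt_welfare n m (\<lambda>i. hidden_val q s k (planted n k r i))"
proof -
  have "real k - real s \<le> hidden_val q s k (planted n k r i) (planted n k r i)" for i
    using assms by (simp add: hidden_val_def level_def card_planted)
  then have "(\<Sum>i\<in>{1..n}. real k - real s)
      \<le> welfare n (\<lambda>i. hidden_val q s k (planted n k r i)) (planted n k r)"
    unfolding welfare_def by (intro sum_mono)
  also have "\<dots> \<le> opt_welfare n m (\<lambda>i. hidden_val q s k (planted n k r i))"
    using assms by (intro welfare_le_opt_welfare allocation_planted)
  finally show ?thesis by simp
qed

section \<open>Few queries succeed on few shifts\<close>

text \<open>A union bound over \<open>L\<close>: if no entry detects the shift, the output is
  \<open>X\<close> with its unplanted welfare, which by \<open>gap\<close> is too small for the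
  planted optimum.\<close>

lemma card_successful_shifts_le:
  assumes n: "0 < n" "n * k \<le> m" and s: "s \<le> k" and q: "0 < q" and A: "legal n m A"
    and \<alpha>: "0 \<le> \<alpha>" and gap: "real m / real q < \<alpha> * (real n * (real k - real s))"
  defines "f0 \<equiv> (\<lambda>_. hidden_val q s k {})"
    and "f \<equiv> (\<lambda>r i. hidden_val q s k (planted n k r i))"
  shows "card {r \<in> shifts n k. approximates n m \<alpha> (f r) (run A (f r))} * n ^ Suc s
    \<le> (queries A f0 + n) * (n ^ k * 2 ^ ((q + 1) * k))"
proof -
  define X where "X = run A f0"
  \<comment> \<open>The output bundles count as \<open>n\<close> further queries, so that the output is also worth the same.\<close>
  define L where "L = trace A f0 @
    (if allocation n m X then map (\<lambda>i. (i, X i)) [1..<Suc n] else [])"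
  have "length L \<le> queries A f0 + n" by (simp add: L_def length_trace)
  define D where "D = (\<lambda>(i, S). {r \<in> shifts n k. f r i S \<noteq> f0 i S})"
  have "finite (shifts n k)" by (intro finite_PiE) auto
  then have finD: "finite (D x)" for x by (cases x) (simp add: D_def)
  have D: "card (D x) * n ^ Suc s \<le> n ^ k * 2 ^ ((q + 1) * k)" if "x \<in> set L" for x
  proof -
    obtain i S where x: "x = (i, S)" by force
    have "S \<subseteq> {1..m}"
      using that x legal_trace[OF A] by (auto simp: L_def allocation_def split: if_splits)
    then have "finite S" by (rule finite_subset) simp
    from card_distinguishing_shifts_le[OF n(1) this q]
    show ?thesis by (simp add: x D_def f_def f0_def)
  qed
  have "{r \<in> shifts n k. approximates n m \<alpha> (f r) (run A (f r))} \<subseteq> (\<Union>x\<in>set L. D x)"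
  proof (intro subsetI, rule ccontr)
    fix r assume r: "r \<in> {r \<in> shifts n k. approximates n m \<alpha> (f r) (run A (f r))}"
      and "r \<notin> (\<Union>x\<in>set L. D x)"
    then have eq: "f r i S = f0 i S" if "(i, S) \<in> set L" for i S
      using that by (auto simp: D_def)
    then have run: "run A (f r) = X"
      unfolding X_def by (intro run_cong) (auto simp: L_def)
    then have alloc: "allocation n m X" using r by (auto simp: approximates_def)
    then have "welfare n (f r) X = welfare n f0 X"
      unfolding welfare_def by (intro sum.cong refl eq) (auto simp: L_def simp del: upt_Suc)
    also have "\<dots> \<le> real m / real q"
      unfolding f0_def by (rule welfare_hidden_val_empty_le[OF alloc])
    also note gap
    also have "\<alpha> * (real n * (real k - real s)) \<le> \<alpha> * opt_welfare n m (f r)"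
      unfolding f_def using \<alpha> n s by (intro mult_left_mono opt_welfare_planted_ge)
    finally show False using r run by (auto simp: approximates_def)
  qed
  then have "card {r \<in> shifts n k. approximates n m \<alpha> (f r) (run A (f r))}
      \<le> card (\<Union>x\<in>set L. D x)"
    using finD by (intro card_mono finite_UN_I) auto
  also have "\<dots> \<le> (\<Sum>x\<in>set L. card (D x))" by (rule card_UN_le) simp
  finally have "card {r \<in> shifts n k. approximates n m \<alpha> (f r) (run A (f r))} * n ^ Suc s
      \<le> (\<Sum>x\<in>set L. card (D x)) * n ^ Suc s"
    by (rule mult_le_mono1)
  also have "\<dots> = (\<Sum>x\<in>set L. card (D x) * n ^ Suc s)" by (rule sum_distrib_right)
  also have "\<dots> \<le> of_nat (card (set L)) * (n ^ k * 2 ^ ((q + 1) * k))"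
    using D by (intro sum_bounded_above)
  also have "\<dots> \<le> (queries A f0 + n) * (n ^ k * 2 ^ ((q + 1) * k))"
    using card_length[of L] \<open>length L \<le> queries A f0 + n\<close> by (intro mult_le_mono1) simp
  finally show ?thesis .
qed

text \<open>Summing the success probabilities over \<open>\<Omega>\<close> gives the expected number
  of successful \<open>r\<close>.\<close>

lemma (in prob_space) success_averaging:
  assumes \<Omega>: "finite \<Omega>" and B: "\<And>r. r \<in> \<Omega> \<Longrightarrow> p \<le> prob {x \<in> space M. P r x}" and p: "0 < p"
    and bound: "AE x in M. real (card {r \<in> \<Omega>. P r x}) \<le> C"
  shows "p * real (card \<Omega>) \<le> C"
proof -
  \<comment> \<open>Non-measurable sets have measure \<open>0\<close>, so a positive lower bound
    implies measurability.\<close>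
  have meas: "{x \<in> space M. P r x} \<in> events" if "r \<in> \<Omega>" for r
    using B[OF that] p measure_notin_sets by fastforce
  have "p * real (card \<Omega>) \<le> (\<Sum>r\<in>\<Omega>. prob {x \<in> space M. P r x})"
    using sum_mono[of \<Omega> "\<lambda>_. p"] B by (simp add: mult.commute)
  also have "\<dots> = (\<Sum>r\<in>\<Omega>. expectation (indicator {x \<in> space M. P r x}))"
    by (intro sum.cong refl) (auto intro!: arg_cong[where f = prob])
  also have "\<dots> = expectation (\<lambda>x. \<Sum>r\<in>\<Omega>. indicator {x \<in> space M. P r x} x)"
    using meas by (intro Bochner_Integration.integral_sum[symmetric]) (simp add: integrable_indicator_iff emeasure_eq_measure)
  also have "\<dots> \<le> expectation (\<lambda>_. C)"
  proof (rule integral_mono_AE)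
    show "AE x in M. (\<Sum>r\<in>\<Omega>. indicator {x \<in> space M. P r x} x) \<le> C"
      using bound AE_space
    proof eventually_elim
      case (elim x)
      then have "(\<Sum>r\<in>\<Omega>. indicator {x \<in> space M. P r x} x) = real (card {r \<in> \<Omega>. P r x})"
        using \<Omega> by (simp add: indicator_def sum.If_cases Int_def)
      then show ?case using elim by simp
    qed
  qed (use meas in \<open>auto intro!: Bochner_Integration.integrable_sum simp: integrable_indicator_iff emeasure_eq_measure\<close>)
  finally show ?thesis by (simp add: prob_space)
qed

section \<open>The hard family and the lower bounds\<close>

text \<open>The side conditions are those of \<open>SMW_hidden_val\<close>, so the width is right
  for all \<open>n\<close> and \<open>m\<close>; for degenerate parameters the family is empty. It
  is independent of \<open>p\<close> and contains planted and unplanted instances alike.\<close>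

definition hard_family :: "nat \<Rightarrow> real \<Rightarrow> nat \<Rightarrow> nat \<Rightarrow> welfare_inst set" where
  "hard_family d \<delta> n m =
     {\<lambda>i. hidden_val (Suc d) (nat \<lfloor>\<delta> * real (m div n)\<rfloor>) (m div n) (T i) | T.
        1 \<le> m div n \<and> (\<forall>i\<in>{1..n}. d < card ({1..m} - T i))}"

lemma hard_family_valuation_SMW:
  "f \<in> hard_family d \<delta> n m \<Longrightarrow> i \<in> {1..n} \<Longrightarrow> valuation m (f i) \<and> SMW m (f i) = d"
  unfolding hard_family_def by (auto intro: valuation_hidden_val SMW_hidden_val)

text \<open>Averaging bounds \<open>p * n ^ k\<close> by the number of shifts on which a cheap
  algorithm can succeed, contradicting \<open>query_bound_dominated\<close>. The probability
  \<open>p\<close> affects only the threshold \<open>N\<close>.\<close>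

lemma hard_family_randomized:
  fixes d :: nat and \<epsilon> p :: real
  assumes \<epsilon>: "\<epsilon> > 0" and p: "p > 0"
  defines "\<alpha> \<equiv> 1 / (real d + 1) + \<epsilon>"
  defines "\<delta> \<equiv> \<epsilon> / (2 * \<alpha>)"
  shows "\<exists>N. \<forall>n\<ge>N. \<forall>m\<ge>N * n. \<forall>R. randomized_alg n m R \<and>
      (\<forall>f\<in>hard_family d \<delta> n m. success_prob n m \<alpha> R f \<ge> p) \<longrightarrow>
      (\<exists>f\<in>hard_family d \<delta> n m. \<not> (AE A in R. real (queries A f) < query_bound d n m))"
proof -
  have \<alpha>: "\<alpha> > \<epsilon>" "\<alpha> > 0" using \<epsilon> by (simp_all add: \<alpha>_def add_pos_pos)
  \<comment> \<open>By the choice of \<open>\<delta>\<close>,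
    \<open>\<alpha> * (1 - \<delta>)\<close> equals \<open>1 / (d + 1) + \<epsilon> / 2\<close>, so
    half of the surplus survives the loss of \<open>s\<close> items per hidden set.\<close>
  have \<delta>: "0 < \<delta>" "\<delta> \<le> 1" "\<alpha> * \<delta> = \<epsilon> / 2" using \<epsilon> \<alpha> by (auto simp: \<delta>_def field_simps)
  obtain N0 where N0: "\<And>n m. n \<ge> N0 \<Longrightarrow> m \<ge> N0 * n \<Longrightarrow>
    (query_bound d n m + real n) * 2 ^ ((d + 2) * (m div n))
      < p * real n ^ Suc (nat \<lfloor>\<delta> * real (m div n)\<rfloor>)"
    using query_bound_dominated[OF \<delta>(1) p, of d] by blast
  \<comment> \<open>The entry \<open>d + 2\<close> gives two agents and enough items outside each
    hidden set; the last entry absorbs the remainder of \<open>m\<close> modulo \<open>n\<close> in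
    \<open>gap\<close>.\<close>
  define N where "N = Max {N0, d + 2, nat \<lceil>2 / \<epsilon>\<rceil> + 1}"
  have N: "N0 \<le> N" "d + 2 \<le> N" "2 / \<epsilon> < real N"
  proof -
    show "N0 \<le> N" "d + 2 \<le> N" by (auto simp: N_def)
    have "nat \<lceil>2 / \<epsilon>\<rceil> + 1 \<le> N" by (auto simp: N_def)
    then show "2 / \<epsilon> < real N" by linarith
  qed
  have False if nN: "n \<ge> N" and mN: "m \<ge> N * n" and R: "randomized_alg n m R"
    and succ: "\<And>f. f \<in> hard_family d \<delta> n m \<Longrightarrow> success_prob n m \<alpha> R f \<ge> p"
    and few: "\<And>f. f \<in> hard_family d \<delta> n m \<Longrightarrow> AE A in R. real (queries A f) < query_bound d n m"
    for n m R
  proof -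
    define k s q where "k = m div n" and "s = nat \<lfloor>\<delta> * real k\<rfloor>" and "q = Suc d"
    define f0 :: welfare_inst where "f0 = (\<lambda>_. hidden_val q s k {})"
    define f where "f = (\<lambda>r i. hidden_val q s k (planted n k r i))"
    interpret prob_space R using R by (simp add: randomized_alg_def)
    have n: "2 \<le> n" "0 < n" using nN N by auto
    have kN: "N \<le> k" unfolding k_def using mN n by (simp add: less_eq_div_iff_mult_less_eq)
    have nk: "n * k \<le> m" by (simp add: k_def)
    have s\<delta>: "real s \<le> \<delta> * real k" using \<delta> by (simp add: s_def)
    then have sk: "s \<le> k" using \<delta> mult_right_mono[of \<delta> 1 "real k"] by simp
    have large: "d < card ({1..m} - T)" if "T \<subseteq> {1..m}" "card T \<le> k" for T
    proof -
      have "2 * k \<le> n * k" using n by (intro mult_le_mono1)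
      then have "d < m - k" using kN N nk by linarith
      also have "\<dots> \<le> card ({1..m} - T)"
        using that by (simp add: card_Diff_subset finite_subset)
      finally show ?thesis .
    qed
    have fam: "(\<lambda>i. hidden_val q s k (T i)) \<in> hard_family d \<delta> n m"
      if "\<And>i. T i \<subseteq> {1..m} \<and> card (T i) \<le> k" for T
      unfolding hard_family_def q_def s_def k_def
      using large that kN N by (intro CollectI exI[of _ T]) (auto simp: k_def)
    \<comment> \<open>Queries are bounded on this unplanted instance, success on the planted
      ones.\<close>
    have f0: "f0 \<in> hard_family d \<delta> n m" unfolding f0_def by (rule fam) simp
    have f: "f r \<in> hard_family d \<delta> n m" for r
      unfolding f_def using planted_subset[OF n(2) nk] by (intro fam) (simp add: card_planted n)
    have gap: "real m / real q < \<alpha> * (real n * (real k - real s))"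
    proof -
      have "m < n * Suc k" unfolding k_def using n dividend_less_times_div[of n m] by (simp add: algebra_simps)
      then have "real m \<le> real n * (real k + 1)"
        by (metis of_nat_mono of_nat_mult of_nat_Suc less_imp_le add.commute)
      then have "real m / real q \<le> real n * (real k + 1) / real q"
        by (intro divide_right_mono) auto
      also have "\<dots> = real n * (real k / real q + 1 / real q)"
        by (simp add: distrib_left add_divide_distrib)
      also have "\<dots> < real n * (real k / real q + \<epsilon> / 2 * real k)"
      proof -
        have "1 / real q \<le> 1" by (simp add: q_def)
        also have "1 < \<epsilon> / 2 * real N" using N \<epsilon> by (simp add: field_simps)
        also have "\<dots> \<le> \<epsilon> / 2 * real k" using kN \<epsilon> by simp
        finally show ?thesis using n by simp
      qed
      also have "real k / real q + \<epsilon> / 2 * real k = \<alpha> * (real k - \<delta> * real k)"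
      proof -
        have "\<alpha> * (real k - \<delta> * real k) = \<alpha> * real k - (\<alpha> * \<delta>) * real k"
          by (simp add: algebra_simps)
        also have "\<dots> = \<alpha> * real k - \<epsilon> / 2 * real k" by (simp only: \<delta>(3))
        also have "\<dots> = real k / real q + \<epsilon> / 2 * real k"
          by (simp add: \<alpha>_def q_def algebra_simps)
        finally show ?thesis ..
      qed
      also have "real n * (\<alpha> * (real k - \<delta> * real k)) \<le> real n * (\<alpha> * (real k - real s))"
        using s\<delta> \<alpha> by (intro mult_left_mono) auto
      finally show ?thesis by (simp add: mult_ac)
    qed
    define C where "C = (query_bound d n m + real n) * (real n ^ k * 2 ^ ((q + 1) * k)) / real n ^ Suc s"
    have "AE A in R. real (card {r \<in> shifts n k. approximates n m \<alpha> (f r) (run A (f r))}) \<le> C"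
      using few[OF f0] AE_space
    proof eventually_elim
      case (elim A)
      have "legal n m A" using elim R by (auto simp: randomized_alg_def)
      have "real (card {r \<in> shifts n k. approximates n m \<alpha> (f r) (run A (f r))} * n ^ Suc s)
        \<le> real ((queries A f0 + n) * (n ^ k * 2 ^ ((q + 1) * k)))"
        unfolding f_def f0_def
        by (intro of_nat_mono card_successful_shifts_le)
           (use n nk sk gap \<alpha> \<open>legal n m A\<close> in \<open>auto simp: q_def\<close>)
      also have "\<dots> = (real (queries A f0) + real n) * (real n ^ k * 2 ^ ((q + 1) * k))"
        by simp
      also have "\<dots> \<le> (query_bound d n m + real n) * (real n ^ k * 2 ^ ((q + 1) * k))"
        using elim by (intro mult_right_mono) auto
      finally show ?case using n by (simp add: C_def field_simps)
    qed
    moreover have "p \<le> prob {A \<in> space R. approximates n m \<alpha> (f r) (run A (f r))}" for r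
      using succ[OF f] by (simp add: success_prob_def)
    ultimately have "p * real (card (shifts n k)) \<le> C"
      using p by (intro success_averaging) (auto intro: finite_PiE)
    then have "real n ^ k * p
        \<le> real n ^ k * ((query_bound d n m + real n) * 2 ^ ((q + 1) * k) / real n ^ Suc s)"
      by (simp add: C_def card_PiE mult_ac)
    then have "p \<le> (query_bound d n m + real n) * 2 ^ ((q + 1) * k) / real n ^ Suc s"
      using n by (subst (asm) mult_le_cancel_left_pos) auto
    then have "p * real n ^ Suc s \<le> (query_bound d n m + real n) * 2 ^ ((q + 1) * k)"
      using n by (subst (asm) pos_le_divide_eq) auto
    moreover have "(query_bound d n m + real n) * 2 ^ ((q + 1) * k) < p * real n ^ Suc s"
      using N0[of n m] nN mN N mult_le_mono1[OF N(1), of n] by (simp add: q_def k_def s_def)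
    ultimately show False by simp
  qed
  then show ?thesis by blast
qed

text \<open>The point mass lives on \<open>{A}\<close>, since every algorithm in the space must be
  legal.\<close>

lemma randomized_alg_return:
  assumes "legal n m A"
  shows "randomized_alg n m (return (count_space {A}) A)"
  using assms by (auto simp: randomized_alg_def intro!: prob_space_return)

lemma success_prob_return:
  assumes "approximates n m \<alpha> f (run A f)"
  shows "success_prob n m \<alpha> (return (count_space {A}) A) f = 1"
proof -
  have "{B \<in> {A}. approximates n m \<alpha> f (run B f)} = {A}" using assms by auto
  then show ?thesis by (simp add: success_prob_def measure_return)
qed

lemma AE_return_count_space: "(AE B in return (count_space {A}) A. P B) \<longleftrightarrow> P A"
  by (subst AE_return) auto

theorem theorem11:
  fixes d :: nat and \<epsilon> :: real
  assumes "\<epsilon> > 0"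
  shows "\<exists>F :: nat \<Rightarrow> nat \<Rightarrow> welfare_inst set.
    (\<forall>n m. \<forall>f\<in>F n m. \<forall>i\<in>{1..n}. valuation m (f i) \<and> SMW m (f i) = d) \<and>
    (\<exists>c>0. \<exists>N. \<forall>n\<ge>N. \<forall>m\<ge>N * n. \<forall>A.
       legal n m A \<and>
       (\<forall>f\<in>F n m. approximates n m (1 / (real d + 1) + \<epsilon>) f (run A f)) \<longrightarrow>
       (\<exists>f\<in>F n m. real (queries A f) \<ge> c * query_bound d n m)) \<and>
    (\<forall>p\<in>{0<..1}. \<exists>c>0. \<exists>N. \<forall>n\<ge>N. \<forall>m\<ge>N * n. \<forall>R.
       randomized_alg n m R \<and>
       (\<forall>f\<in>F n m. success_prob n m (1 / (real d + 1) + \<epsilon>) R f \<ge> p) \<longrightarrow>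
       (\<exists>f\<in>F n m. \<not> (AE A in R. real (queries A f) < c * query_bound d n m)))"
proof -
  let ?\<alpha> = "1 / (real d + 1) + \<epsilon>"
  let ?F = "hard_family d (\<epsilon> / (2 * ?\<alpha>))"
  note rand = hard_family_randomized[OF assms, of _ d]
  \<comment> \<open>A correct deterministic algorithm is the case \<open>p = 1\<close>.\<close>
  obtain N where N: "\<And>n m R. n \<ge> N \<Longrightarrow> m \<ge> N * n \<Longrightarrow> randomized_alg n m R \<Longrightarrow>
      (\<forall>f\<in>?F n m. success_prob n m ?\<alpha> R f \<ge> 1) \<Longrightarrow>
      (\<exists>f\<in>?F n m. \<not> (AE A in R. real (queries A f) < query_bound d n m))"
    using rand[OF zero_less_one] by blast
  have det: "\<exists>f\<in>?F n m. real (queries A f) \<ge> query_bound d n m"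
    if "n \<ge> N" "m \<ge> N * n" "legal n m A" "\<forall>f\<in>?F n m. approximates n m ?\<alpha> f (run A f)" for n m A
    using N[OF that(1,2) randomized_alg_return[OF that(3)]] that(4)
    by (auto simp: success_prob_return AE_return_count_space not_less)
  show ?thesis
  proof (intro exI[of _ ?F] conjI)
    show "\<forall>n m. \<forall>f\<in>?F n m. \<forall>i\<in>{1..n}. valuation m (f i) \<and> SMW m (f i) = d"
      using hard_family_valuation_SMW by blast
    show "\<exists>c>0. \<exists>N. \<forall>n\<ge>N. \<forall>m\<ge>N * n. \<forall>A.
       legal n m A \<and> (\<forall>f\<in>?F n m. approximates n m ?\<alpha> f (run A f)) \<longrightarrow>
       (\<exists>f\<in>?F n m. real (queries A f) \<ge> c * query_bound d n m)"
      using det by (intro exI[of _ 1] conjI exI[of _ N]) auto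
    show "\<forall>p\<in>{0<..1}. \<exists>c>0. \<exists>N. \<forall>n\<ge>N. \<forall>m\<ge>N * n. \<forall>R.
       randomized_alg n m R \<and> (\<forall>f\<in>?F n m. success_prob n m ?\<alpha> R f \<ge> p) \<longrightarrow>
       (\<exists>f\<in>?F n m. \<not> (AE A in R. real (queries A f) < c * query_bound d n m))"
    proof
      fix p :: real assume "p \<in> {0<..1}"
      then have "0 < p" by simp
      from rand[OF this] show "\<exists>c>0. \<exists>N. \<forall>n\<ge>N. \<forall>m\<ge>N * n. \<forall>R.
       randomized_alg n m R \<and> (\<forall>f\<in>?F n m. success_prob n m ?\<alpha> R f \<ge> p) \<longrightarrow>
       (\<exists>f\<in>?F n m. \<not> (AE A in R. real (queries A f) < c * query_bound d n m))"
        by (intro exI[of _ 1]) simp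
    qed
  qed
qed

end
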